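(* Let $w$ be a permutation. The graph $G_{D(w)}$ is a forest if and only if $w$ avoids the patterns $3412$, $4312$, $3421$, and $4321$.
   Context: For $w\in S_n$, $D(w)=\{(i,w(j)): 1\le i<j\le n,\ w(i)>w(j)\}$. For a finite set $D$ of cells $(i,j)$ (row $i$, column $j$), $G_D$ is the bipartite graph whose two (disjoint) vertex classes are the set of rows and the set of columns of a rectangle containing $D$, with an edge joining row vertex $i$ and column vertex $j$ if and only if $(i,j)\in D$. A permutation $w$ contains $v\in S_m$ as a pattern if there are $i_1<\cdots<i_m$ such that $w(i_1)\cdots w(i_m)$ is in the same relative order as $v(1)\cdots v(m)$; otherwise $w$ avoids $v$. *)

theory Defs
  imports "HOL-Combinatorics.Permutations" "Graph_Theory.Pair_Digraph"
begin

(* A permutation w in S_n is a function w :: nat => nat with w permutes {1..n}. *)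

definition rothe_diagram :: "nat \<Rightarrow> (nat \<Rightarrow> nat) \<Rightarrow> (nat \<times> nat) set" where
  "rothe_diagram n w = {(i, w j) | i j. 1 \<le> i \<and> i < j \<and> j \<le> n \<and> w i > w j}"

(* An undirected simple graph is represented as a symmetric loop-free digraph (pair_graph):
   each edge appears as two opposite arcs. Row i is the vertex Inl i and column j the vertex
   Inr j, so that the two vertex classes are disjoint. *)
definition cell_graph ::
  "nat set \<Rightarrow> nat set \<Rightarrow> (nat \<times> nat) set \<Rightarrow> (nat + nat) pair_pre_digraph" where
  "cell_graph R C D =
     \<lparr> pverts = Inl ` R \<union> Inr ` C,
       parcs = {(Inl i, Inr j) | i j. (i, j) \<in> D} \<union> {(Inr j, Inl i) | i j. (i, j) \<in> D} \<rparr>"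

lemma pair_graph_cell_graph:
  assumes "finite R" "finite C" "D \<subseteq> R \<times> C"
  shows "pair_graph (cell_graph R C D)"
proof
  let ?G = "cell_graph R C D"
  show "finite (pverts ?G)"
    using assms by (simp add: cell_graph_def)
  have "parcs ?G \<subseteq> (\<lambda>(i, j). (Inl i, Inr j)) ` D \<union> (\<lambda>(i, j). (Inr j, Inl i)) ` D"
    by (auto simp: cell_graph_def)
  moreover have "finite D"
    using assms finite_subset by blast
  ultimately show "finite (parcs ?G)"
    by (meson finite_UnI finite_imageI finite_subset)
  show "symmetric (with_proj ?G)"
    by (auto simp: symmetric_def sym_def cell_graph_def)
qed (use assms in \<open>auto simp: cell_graph_def\<close>)

(* The library's forest predicate is about directed cycles, and the library counts the
   back-and-forth walk u, v, u along a single edge as one. Under the symmetric encoding that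
   walk is no cycle of the undirected graph, so cycles must have at least three arcs. *)
definition undirected_forest :: "'a pair_pre_digraph \<Rightarrow> bool" where
  "undirected_forest G \<longleftrightarrow> \<not> (\<exists>p. pre_digraph.cycle (with_proj G) p \<and> 3 \<le> length p)"

definition contains_pattern :: "nat \<Rightarrow> (nat \<Rightarrow> nat) \<Rightarrow> nat \<Rightarrow> (nat \<Rightarrow> nat) \<Rightarrow> bool" where
  "contains_pattern n w m v \<longleftrightarrow>
     (\<exists>i. strict_mono_on {1..m} i \<and> i ` {1..m} \<subseteq> {1..n} \<and>
          (\<forall>a\<in>{1..m}. \<forall>b\<in>{1..m}. w (i a) < w (i b) \<longleftrightarrow> v a < v b))"

definition avoids_pattern :: "nat \<Rightarrow> (nat \<Rightarrow> nat) \<Rightarrow> nat \<Rightarrow> (nat \<Rightarrow> nat) \<Rightarrow> bool" where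
  "avoids_pattern n w m v \<longleftrightarrow> \<not> contains_pattern n w m v"

(* The function with one-line notation xs, positions being numbered from 1; it is the
   identity outside {1..length xs}, as permutes demands. *)
definition one_line :: "nat list \<Rightarrow> nat \<Rightarrow> nat" where
  "one_line xs k = (if k \<in> {1..length xs} then xs ! (k - 1) else k)"

lemma one_line_permutes:
  assumes "distinct xs" "set xs = {1..length xs}"
  shows "one_line xs permutes {1..length xs}"
proof (rule bij_imp_permutes)
  have "bij_betw (\<lambda>k. k - 1) {1..length xs} {..<length xs}"
    by (rule bij_betw_byWitness[where f' = Suc]) auto
  then have "bij_betw ((!) xs \<circ> (\<lambda>k. k - 1)) {1..length xs} (set xs)"
    using assms(1) bij_betw_nth[of xs "{..<length xs}" "set xs"] bij_betw_trans by blast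
  then show "bij_betw (one_line xs) {1..length xs} {1..length xs}"
    using assms(2) by (subst bij_betw_cong[where g = "(!) xs \<circ> (\<lambda>k. k - 1)"])
      (auto simp: one_line_def)
qed (auto simp: one_line_def)

end

theory Submission
  imports Defs
begin

text \<open>
  Avoiding the four patterns means that no positions \<open>a < b < c < d\<close> have both \<open>w a\<close> and \<open>w b\<close>
  above both \<open>w c\<close> and \<open>w d\<close>. Such positions give the 4-cycle on the rows \<open>a\<close>, \<open>b\<close> and the columns
  \<open>w c\<close>, \<open>w d\<close>. Conversely, let \<open>b\<close> be the largest row of a cycle, \<open>x < y\<close> its two neighbours on
  the cycle, and \<open>a < b\<close> the other neighbour of \<open>y\<close>. The columns \<open>x\<close>, \<open>y\<close> are values of \<open>w\<close> at
  positions after \<open>b\<close>, and \<open>w a > y > x\<close>, so \<open>a\<close>, \<open>b\<close> and these positions are of the required form.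
\<close>

section \<open>Cycles in digraphs and in cell graphs\<close>

lemma (in pre_digraph) cas_imp_tail_last:
  assumes "cas u (p @ [c, d] @ q) v"
  shows "tail G d = head G c"
  using assms by (induction p arbitrary: u) auto

text \<open>A closed walk may start at any of its vertices, here the one where \<open>q\<close>
  ends. This serves to move a chosen arc to the last place.\<close>

lemma (in pre_digraph) cas_rotate:
  assumes "cas u (q @ r) u"
  shows "\<exists>v. cas v (r @ q) v"
proof -
  have app: "cas a (p @ p') b \<longleftrightarrow> (\<exists>v. cas a p v \<and> cas v p' b)" for a p p' b
    by (induction p arbitrary: a) auto
  show ?thesis using assms unfolding app by blast
qed

text \<open>With \<open>e\<close> rotated to the end, \<open>d\<close> is the arc before it and
  \<open>f\<close> the first arc of the walk. The two inequalities say that the walk does not turn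
  back along \<open>e\<close>; a walk of two arcs would, hence the length bound.\<close>

lemma (in pre_digraph) closed_walk_neighbours:
  assumes "cas u p u" "distinct (map (head G) p)" "3 \<le> length p" "e \<in> set p"
  obtains d f where "d \<in> set p" "head G d = tail G e" "tail G d \<noteq> head G e"
    "f \<in> set p" "tail G f = head G e" "head G f \<noteq> tail G e"
proof -
  obtain q r where p: "p = q @ e # r"
    using assms(4) by (meson split_list)
  define s where "s = r @ q"
  have s2: "2 \<le> length s"
    using assms(3) p by (auto simp: s_def)
  obtain v where v: "cas v (s @ [e]) v"
    using cas_rotate[of u "q @ [e]" r] assms(1) p by (auto simp: s_def)
  have dist: "distinct (map (head G) (s @ [e]))" and set_s: "set s \<subseteq> set p"
    using assms(2) p by (auto simp: s_def)
  obtain f s' where f: "s = f # s'"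
    using s2 by (cases s) auto
  obtain t' d where d: "s = t' @ [d]"
    using s2 by (cases s rule: rev_cases) auto
  obtain t c where c: "s = t @ [c, d]"
    using s2 d by (cases t' rule: rev_cases) auto
  have cas_last: "head G z = b" if "cas a (y @ [z]) b" for a y z b
    using that by (induction y arbitrary: a) auto
  \<comment> \<open>As \<open>s\<close> has at least two arcs, \<open>f\<close> lies strictly before
    \<open>d\<close> (it may equal \<open>c\<close>), so distinctness of heads applies.\<close>
  have "f \<in> set (t @ [c])"
    using f c by (cases t) auto
  moreover have "head G d \<notin> head G ` set (t @ [c])"
    using dist by (auto simp: c)
  ultimately have "head G f \<noteq> head G d"
    by (metis imageI)
  have "tail G f = v" "head G e = v"
    using v cas_last[OF v] by (simp_all add: f)
  moreover have "tail G e = head G d"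
    using v cas_imp_tail_last[of v t' d e "[]" v] by (simp add: d)
  moreover have "tail G d = head G c"
    using v cas_imp_tail_last[of v t c d "[e]" v] by (simp add: c)
  moreover have "head G c \<noteq> head G e"
    using dist by (simp add: c)
  moreover have "d \<in> set p"
    using set_s c by auto
  moreover have "f \<in> set p"
    using set_s f by auto
  ultimately show thesis
    using that[of d f] \<open>head G f \<noteq> head G d\<close> by simp
qed

text \<open>The fourth corner \<open>(a, x)\<close> need not lie in \<open>D\<close>, as 6-cycles
  show. For a Rothe diagram the inequality \<open>x < y\<close> will make up for it.\<close>

lemma cell_graph_cycle_imp_rectangle_corner:
  assumes "pre_digraph.cycle (with_proj (cell_graph R C D)) p" "3 \<le> length p"
  obtains a b x y where "a < b" "x < y" "(a, y) \<in> D" "(b, x) \<in> D" "(b, y) \<in> D"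
proof -
  interpret pre_digraph "with_proj (cell_graph R C D)" .
  obtain u where u: "awalk u p u" "distinct (tl (awalk_verts u p))" "p \<noteq> []"
    using assms(1) by (auto simp: cycle_def)
  then have cas: "cas u p u" and arcs: "set p \<subseteq> parcs (cell_graph R C D)"
    by (auto simp: awalk_def)
  \<comment> \<open>The vertices of a nonempty walk after its first one are the heads of its
    arcs.\<close>
  have dist: "distinct (map snd p)"
    using u(2,3) by (simp add: awalk_verts_conv'[OF cas])
  have nb: "\<exists>d\<in>set p. \<exists>f\<in>set p. snd d = fst e \<and> fst d \<noteq> snd e \<and> fst f = snd e \<and> snd f \<noteq> fst e"
    if "e \<in> set p" for e
    using closed_walk_neighbours[OF cas _ assms(2) that] dist by simp metis
  \<comment> \<open>The rows entered by the cycle. Each row that it leaves is also entered, by the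
    preceding arc, so these are all its rows.\<close>
  define Rs where "Rs = Inl -` snd ` set p"
  have edge_cases: "(\<exists>i j. e = (Inl i, Inr j) \<and> (i, j) \<in> D) \<or> (\<exists>i j. e = (Inr j, Inl i) \<and> (i, j) \<in> D)"
    if "e \<in> set p" for e
    using that arcs by (auto simp: cell_graph_def)
  have fst_row: "i \<in> Rs" if z: "(Inl i, z) \<in> set p" for i z
  proof -
    obtain d where "d \<in> set p" "snd d = Inl i"
      using nb[OF z] by auto
    then show ?thesis
      unfolding Rs_def by (metis imageI vimageI)
  qed
  have snd_row: "i \<in> Rs" if "(z, Inl i) \<in> set p" for i z
    using that unfolding Rs_def by force
  have fin: "finite Rs"
    by (simp add: Rs_def finite_vimageI)
  have "hd p \<in> set p"
    using u(3) by simp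
  then have ne: "Rs \<noteq> {}"
    using edge_cases[of "hd p"] fst_row snd_row by fastforce
  define b where "b = Max Rs"
  have le_b: "a \<le> b" if "a \<in> Rs" for a
    using that fin by (simp add: b_def)
  have "b \<in> Rs"
    using fin ne by (simp add: b_def)
  then obtain e where e: "e \<in> set p" "snd e = Inl b"
    by (auto simp: Rs_def)
  obtain x where x: "e = (Inr x, Inl b)" "(b, x) \<in> D"
    using edge_cases[OF e(1)] e(2) by auto
  obtain d f where df: "d \<in> set p" "f \<in> set p" "snd d = Inr x" "fst d \<noteq> Inl b"
      "fst f = Inl b" "snd f \<noteq> Inr x"
    using nb[OF e(1)] x by auto
  obtain y where y: "f = (Inl b, Inr y)" "(b, y) \<in> D" "y \<noteq> x"
    using edge_cases[OF df(2)] df by auto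
  show thesis
  \<comment> \<open>The cycle reaches row \<open>b\<close> from column \<open>x\<close> and goes on
    to column \<open>y\<close>. The row \<open>a\<close> is sought beyond the larger column:
    forwards after \<open>f\<close> if that is \<open>y\<close>, backwards at the start of
    \<open>d\<close> if it is \<open>x\<close>.\<close>
  proof (cases "x < y")
    case True
    obtain g where g: "g \<in> set p" "fst g = Inr y" "snd g \<noteq> Inl b"
      using nb[OF df(2)] y by auto
    then obtain a where a: "g = (Inr y, Inl a)" "(a, y) \<in> D" "a \<noteq> b"
      using edge_cases[OF g(1)] by auto
    then have "a < b"
      using le_b[OF snd_row] g(1) by (metis le_neq_implies_less)
    with that True a x y show thesis by blast
  next
    case False
    obtain a where a: "d = (Inl a, Inr x)" "(a, x) \<in> D" "a \<noteq> b"
      using edge_cases[OF df(1)] df by auto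
    then have "a < b"
      using le_b[OF fst_row] df(1) by (metis le_neq_implies_less)
    with that[of a b y x] False a x y show thesis by auto
  qed
qed

lemma cell_graph_rectangle_imp_cycle:
  assumes "D \<subseteq> R \<times> C" "a \<noteq> b" "x \<noteq> y"
    and "(a, x) \<in> D" "(a, y) \<in> D" "(b, x) \<in> D" "(b, y) \<in> D"
  shows "pre_digraph.cycle (with_proj (cell_graph R C D))
    [(Inl a, Inr x), (Inr x, Inl b), (Inl b, Inr y), (Inr y, Inl a)]"
  unfolding pre_digraph.cycle_def pre_digraph.awalk_def
  using assms
  by (intro exI[of _ "Inl a"])
    (auto simp: cell_graph_def pre_digraph.cas.simps pre_digraph.awalk_verts.simps)

section \<open>Forests of Rothe diagrams\<close>

definition inverted_blocks :: "nat \<Rightarrow> (nat \<Rightarrow> nat) \<Rightarrow> nat \<Rightarrow> nat \<Rightarrow> nat \<Rightarrow> nat \<Rightarrow> bool" where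
  "inverted_blocks n w a b c d \<longleftrightarrow> 1 \<le> a \<and> a < b \<and> b < c \<and> c < d \<and> d \<le> n \<and>
     w c < w a \<and> w d < w a \<and> w c < w b \<and> w d < w b"

lemma undirected_forest_rothe_iff:
  assumes "inj w" "rothe_diagram n w \<subseteq> R \<times> C"
  shows "undirected_forest (cell_graph R C (rothe_diagram n w)) \<longleftrightarrow>
    (\<nexists>a b c d. inverted_blocks n w a b c d)"
proof -
  let ?D = "rothe_diagram n w"
  have "\<exists>a b c d. inverted_blocks n w a b c d"
    if cyc: "pre_digraph.cycle (with_proj (cell_graph R C ?D)) p" "3 \<le> length p" for p
  proof -
    obtain a b x y where *: "a < b" "x < y" "(a, y) \<in> ?D" "(b, x) \<in> ?D" "(b, y) \<in> ?D"
      using cell_graph_cycle_imp_rectangle_corner[OF cyc] by blast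
    then obtain i j where "x = w i" "b < i" "i \<le> n" "x < w b" "y = w j" "b < j" "j \<le> n" "y < w b"
      by (auto simp: rothe_diagram_def)
    moreover have "1 \<le> a" "y < w a"
      using *(3) by (auto simp: rothe_diagram_def)
    \<comment> \<open>\<open>x < y\<close> orders the values at \<open>i\<close> and
      \<open>j\<close>, not these positions. Either order will do, since
      \<open>inverted_blocks\<close> does not compare \<open>w c\<close> with
      \<open>w d\<close>.\<close>
    moreover have "i < j \<or> j < i"
      using calculation \<open>x < y\<close> by (metis less_irrefl linorder_less_linear)
    ultimately have "inverted_blocks n w a b i j \<or> inverted_blocks n w a b j i"
      using *(1,2) by (auto simp: inverted_blocks_def)
    then show ?thesis by blast
  qed
  moreover have "\<exists>p. pre_digraph.cycle (with_proj (cell_graph R C ?D)) p \<and> 3 \<le> length p"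
    if q: "inverted_blocks n w a b c d" for a b c d
  proof -
    have "w c \<noteq> w d" "a \<noteq> b"
      using q assms(1) by (auto simp: inverted_blocks_def inj_eq)
    moreover have "(a, w c) \<in> ?D" "(a, w d) \<in> ?D" "(b, w c) \<in> ?D" "(b, w d) \<in> ?D"
      using q unfolding inverted_blocks_def rothe_diagram_def by fastforce+
    ultimately show ?thesis
      using cell_graph_rectangle_imp_cycle[OF assms(2), of a b "w c" "w d"]
      by (metis (no_types, lifting) length_Cons list.size(3) numeral_3_eq_3 le_SucI order_refl)
  qed
  ultimately show ?thesis
    unfolding undirected_forest_def by blast
qed

section \<open>Patterns of length four\<close>

lemma ball_1_4: "(\<forall>k\<in>{1..4::nat}. P k) \<longleftrightarrow> P 1 \<and> P 2 \<and> P 3 \<and> P 4"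
proof -
  have "{1..4::nat} = {1, 2, 3, 4}"
    by auto
  then show ?thesis by simp
qed

lemma one_line_4:
  "one_line [p, q, r, s] 1 = p" "one_line [p, q, r, s] 2 = q"
  "one_line [p, q, r, s] 3 = r" "one_line [p, q, r, s] 4 = s"
  by (simp_all add: one_line_def)

lemma contains_pattern_4_iff:
  "contains_pattern n w 4 (one_line [p, q, r, s]) \<longleftrightarrow>
    (\<exists>a b c d. 1 \<le> a \<and> a < b \<and> b < c \<and> c < d \<and> d \<le> n \<and>
      (w a < w b \<longleftrightarrow> p < q) \<and> (w b < w a \<longleftrightarrow> q < p) \<and>
      (w a < w c \<longleftrightarrow> p < r) \<and> (w c < w a \<longleftrightarrow> r < p) \<and>
      (w a < w d \<longleftrightarrow> p < s) \<and> (w d < w a \<longleftrightarrow> s < p) \<and>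
      (w b < w c \<longleftrightarrow> q < r) \<and> (w c < w b \<longleftrightarrow> r < q) \<and>
      (w b < w d \<longleftrightarrow> q < s) \<and> (w d < w b \<longleftrightarrow> s < q) \<and>
      (w c < w d \<longleftrightarrow> r < s) \<and> (w d < w c \<longleftrightarrow> s < r))" (is "?L \<longleftrightarrow> ?R")
proof
  assume ?L
  then obtain i where i: "strict_mono_on {1..4} i" "i ` {1..4} \<subseteq> {1..n}"
    "\<forall>a\<in>{1..4}. \<forall>b\<in>{1..4}. w (i a) < w (i b) \<longleftrightarrow> one_line [p, q, r, s] a < one_line [p, q, r, s] b"
    unfolding contains_pattern_def by blast
  have "i 1 < i 2" "i 2 < i 3" "i 3 < i 4"
    by (rule strict_mono_onD[OF i(1)]; simp)+
  moreover have "1 \<le> i 1" "i 4 \<le> n"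
    using i(2) by (auto simp: image_subset_iff)
  ultimately show ?R
    using i(3) unfolding ball_1_4 one_line_4
    by (elim conjE, intro exI[of _ "i 1"] exI[of _ "i 2"] exI[of _ "i 3"] exI[of _ "i 4"] conjI)
next
  assume ?R
  then obtain a b c d where ord: "1 \<le> a" "a < b" "b < c" "c < d" "d \<le> n" and
    iso: "w a < w b \<longleftrightarrow> p < q" "w b < w a \<longleftrightarrow> q < p"
      "w a < w c \<longleftrightarrow> p < r" "w c < w a \<longleftrightarrow> r < p"
      "w a < w d \<longleftrightarrow> p < s" "w d < w a \<longleftrightarrow> s < p"
      "w b < w c \<longleftrightarrow> q < r" "w c < w b \<longleftrightarrow> r < q"
      "w b < w d \<longleftrightarrow> q < s" "w d < w b \<longleftrightarrow> s < q"
      "w c < w d \<longleftrightarrow> r < s" "w d < w c \<longleftrightarrow> s < r"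
    by (elim exE conjE) (rule that; assumption)
  \<comment> \<open>Here \<open>one_line\<close> encodes the increasing choice of positions, not a
    permutation.\<close>
  let ?i = "one_line [a, b, c, d]"
  have "\<forall>x\<in>{1..4}. \<forall>y\<in>{1..4}. x < y \<longrightarrow> ?i x < ?i y"
    unfolding ball_1_4 one_line_4 using ord by simp
  then have "strict_mono_on {1..4} ?i"
    by (simp add: strict_mono_on_def)
  moreover have "\<forall>x\<in>{1..4}. ?i x \<in> {1..n}"
    unfolding ball_1_4 one_line_4 using ord by simp
  moreover have "\<forall>x\<in>{1..4}. \<forall>y\<in>{1..4}.
      w (?i x) < w (?i y) \<longleftrightarrow> one_line [p, q, r, s] x < one_line [p, q, r, s] y"
    unfolding ball_1_4 one_line_4 iso by simp
  ultimately show ?L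
    unfolding contains_pattern_def by blast
qed

text \<open>The four patterns are the ways to order 3, 4 in the first two places and 1, 2 in the
  last two. Injectivity rules out ties, so the values at \<open>a\<close>, \<open>b\<close>,
  \<open>c\<close>, \<open>d\<close> realise one of them.\<close>

lemma inverted_blocks_iff_contains_pattern:
  assumes "inj w"
  shows "(\<exists>a b c d. inverted_blocks n w a b c d) \<longleftrightarrow>
    contains_pattern n w 4 (one_line [3, 4, 1, 2]) \<or>
    contains_pattern n w 4 (one_line [4, 3, 1, 2]) \<or>
    contains_pattern n w 4 (one_line [3, 4, 2, 1]) \<or>
    contains_pattern n w 4 (one_line [4, 3, 2, 1])" (is "?L \<longleftrightarrow> ?R")
proof
  assume ?L
  then obtain a b c d where ord: "1 \<le> a" "a < b" "b < c" "c < d" "d \<le> n" and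
    less: "w c < w a" "w d < w a" "w c < w b" "w d < w b"
    unfolding inverted_blocks_def by blast
  have "w a \<noteq> w b" "w c \<noteq> w d"
    using ord assms by (auto simp: inj_eq)
  then consider "w a < w b" "w c < w d" | "w b < w a" "w c < w d"
    | "w a < w b" "w d < w c" | "w b < w a" "w d < w c"
    by linarith
  then show ?R
  proof cases
    case 1
    then have "contains_pattern n w 4 (one_line [3, 4, 1, 2])"
      unfolding contains_pattern_4_iff using ord less
      by (intro exI[of _ a] exI[of _ b] exI[of _ c] exI[of _ d]) simp
    then show ?thesis by blast
  next
    case 2
    then have "contains_pattern n w 4 (one_line [4, 3, 1, 2])"
      unfolding contains_pattern_4_iff using ord less
      by (intro exI[of _ a] exI[of _ b] exI[of _ c] exI[of _ d]) simp
    then show ?thesis by blast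
  next
    case 3
    then have "contains_pattern n w 4 (one_line [3, 4, 2, 1])"
      unfolding contains_pattern_4_iff using ord less
      by (intro exI[of _ a] exI[of _ b] exI[of _ c] exI[of _ d]) simp
    then show ?thesis by blast
  next
    case 4
    then have "contains_pattern n w 4 (one_line [4, 3, 2, 1])"
      unfolding contains_pattern_4_iff using ord less
      by (intro exI[of _ a] exI[of _ b] exI[of _ c] exI[of _ d]) simp
    then show ?thesis by blast
  qed
next
  \<comment> \<open>Only comparisons between the first and the last two entries are kept, so one
    argument covers all four patterns.\<close>
  have block: ?L if "contains_pattern n w 4 (one_line [p, q, r, s])" "r < p" "r < q" "s < p" "s < q"
    for p q r s
  proof -
    from that(1) obtain a b c d where "1 \<le> a" "a < b" "b < c" "c < d" "d \<le> n"
      "w c < w a \<longleftrightarrow> r < p" "w d < w a \<longleftrightarrow> s < p" "w c < w b \<longleftrightarrow> r < q" "w d < w b \<longleftrightarrow> s < q"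
      unfolding contains_pattern_4_iff by (elim exE conjE) (rule that; assumption)
    then have "inverted_blocks n w a b c d"
      using that by (simp add: inverted_blocks_def)
    then show ?thesis by blast
  qed
  assume ?R
  then show ?L
    by (elim disjE) (erule block; simp)+
qed

theorem theorem6p9:
  fixes n r r' c c' :: nat and w :: "nat \<Rightarrow> nat"
  assumes "w permutes {1..n}"
    and "rothe_diagram n w \<subseteq> {r..r'} \<times> {c..c'}"
  shows "undirected_forest (cell_graph {r..r'} {c..c'} (rothe_diagram n w)) \<longleftrightarrow>
    avoids_pattern n w 4 (one_line [3, 4, 1, 2]) \<and>
    avoids_pattern n w 4 (one_line [4, 3, 1, 2]) \<and>
    avoids_pattern n w 4 (one_line [3, 4, 2, 1]) \<and>
    avoids_pattern n w 4 (one_line [4, 3, 2, 1])"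
proof -
  have "inj w"
    using assms(1) by (rule permutes_inj)
  then show ?thesis
    using undirected_forest_rothe_iff[OF _ assms(2)] inverted_blocks_iff_contains_pattern
    unfolding avoids_pattern_def by blast
qed

end
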